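(* Let $q>0$ with $q\neq 1$, let $r$ be a real number, and let $x$ be an indeterminate. For $n\ge 0$ let $$\varphi_n(x,r)=\sum_{k=0}^n S(n,k,r)\,x^k,$$ where the generalized $q$-Stirling numbers $S(n,k,r)$ are defined by $S(0,k,r)=[k=0]$ for $k\ge 0$, $S(n,0,r)=[r]^n$ for $n\ge 0$, and $S(n,k,r)=S(n-1,k-1,r)+[k+r]\,S(n-1,k,r)$ for $n,k\ge 1$. For $n\ge 1$ and $m\ge 0$ let $d(n,m)=\det\big(\varphi_{i+j+m}(x,r)\big)_{i,j=0}^{n-1}$. Then $$d(n,0)=q^{\binom{n}{3}}\,(q^r x)^{\binom{n}{2}}\prod_{k=0}^{n-1}[k]!$$ and $$d(n,1)=q^{\binom{n}{3}}\,(q^r x)^{\binom{n}{2}}\prod_{k=0}^{n-1}[k]!\;\sum_{k=0}^n \begin{bmatrix} n\\ k\end{bmatrix} q^{\binom{k}{2}} x^k \prod_{j=0}^{n-k-1}[r+j].$$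
   Context: Notation: $[t]=\frac{1-q^t}{1-q}$ for real $t$; $[n]!=[1][2]\cdots[n]$ for integers $n\ge 0$ (with $[0]!=1$); $\begin{bmatrix} n\\ k\end{bmatrix}=\frac{[n]!}{[k]![n-k]!}$ for integers $0\le k\le n$ and $0$ otherwise; $[P]$ for a statement $P$ is $1$ if $P$ holds and $0$ otherwise. An empty product equals $1$. *)

theory Defs
  imports
    Complex_Main
    "HOL-Computational_Algebra.Polynomial"
    "Jordan_Normal_Form.Determinant"
begin

definition qbracket :: "real \<Rightarrow> real \<Rightarrow> real" where
  "qbracket q t = (1 - q powr t) / (1 - q)"

definition qfact :: "real \<Rightarrow> nat \<Rightarrow> real" where
  "qfact q n = (\<Prod>k=1..n. qbracket q (real k))"

definition qbinom :: "real \<Rightarrow> nat \<Rightarrow> nat \<Rightarrow> real" where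
  "qbinom q n k = (if k \<le> n then qfact q n / (qfact q k * qfact q (n - k)) else 0)"

fun qStirling :: "real \<Rightarrow> real \<Rightarrow> nat \<Rightarrow> nat \<Rightarrow> real" where
  "qStirling q r 0 k = (if k = 0 then 1 else 0)"
| "qStirling q r (Suc n) 0 = qbracket q r ^ Suc n"
| "qStirling q r (Suc n) (Suc k) =
     qStirling q r n k + qbracket q (real (Suc k) + r) * qStirling q r n (Suc k)"

text \<open>The indeterminate \<open>x\<close> is the variable \<^term>\<open>monom 1 1 :: real poly\<close> of the polynomial
  ring over the reals, so that all determinants below are taken in that ring.\<close>

definition phi :: "real \<Rightarrow> real \<Rightarrow> nat \<Rightarrow> real poly" where
  "phi q r n = (\<Sum>k=0..n. monom (qStirling q r n k) k)"

definition hankel_det :: "real \<Rightarrow> real \<Rightarrow> nat \<Rightarrow> nat \<Rightarrow> real poly" where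
  "hankel_det q r n m = det (mat n n (\<lambda>(i, j). phi q r (i + j + m)))"

end

theory Submission
  imports Defs
begin

text \<open>The polynomials \<open>phi n\<close> are the moments of the \<open>q\<close>-Charlier polynomials, whose three-term
  recurrence has the coefficients \<open>b k = [k+r] + q^k x\<close> and \<open>l k = q^(k+r) [k+1] x\<close>. Let \<open>a n k\<close> be the
  Stieltjes array given by \<open>a (n+1) k = a n (k-1) + b k * a n k + l k * a n (k+1)\<close>; solving this recurrence
  explicitly yields \<open>a n k = (\<Sum>j. S(n,j,r) * qbinom j k * x^(j-k))\<close>, so \<open>phi n\<close> is its first column.
  The Hankel matrix of a first column factors as \<open>L D L^T\<close> with \<open>L\<close> unitriangular and
  \<open>D\<close> diagonal with entries \<open>l 0 \<dots> l (k-1)\<close>, and the shifted one as \<open>L J D L^T\<close> with \<open>J\<close> the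
  tridiagonal Jacobi matrix. The determinant of \<open>J\<close> is a continuant, which satisfies the same
  recurrence as the sum in the second formula.\<close>

section \<open>Stieltjes arrays over a commutative ring: symmetry and addition formula\<close>

fun stieltjes :: "(nat \<Rightarrow> 'a::comm_ring_1) \<Rightarrow> (nat \<Rightarrow> 'a) \<Rightarrow> nat \<Rightarrow> nat \<Rightarrow> 'a" where
  "stieltjes b l 0 k = (if k = 0 then 1 else 0)"
| "stieltjes b l (Suc n) k =
     (if k = 0 then 0 else stieltjes b l n (k - 1)) + b k * stieltjes b l n k
       + l k * stieltjes b l n (Suc k)"

lemma stieltjes_eq_0: "n < k \<Longrightarrow> stieltjes b l n k = 0"
  by (induction n arbitrary: k) auto

lemma stieltjes_diag: "stieltjes b l n n = 1"
  by (induction n) (auto simp: stieltjes_eq_0)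

text \<open>The step from one row to the next is self-adjoint for the bilinear form with weights
  \<open>\<Prod>i<k. l i\<close>. The bounds by \<open>N\<close> make the terms beyond column
  \<open>N\<close> vanish.\<close>

lemma stieltjes_shift:
  assumes "m < N" "n < N"
  shows "(\<Sum>k\<le>N. stieltjes b l (Suc m) k * stieltjes b l n k * (\<Prod>i<k. l i))
       = (\<Sum>k\<le>N. stieltjes b l m k * stieltjes b l (Suc n) k * (\<Prod>i<k. l i))"
proof -
  define P where "P k = (\<Prod>i<k. l i)" for k
  \<comment> \<open>\<open>X\<close> collects the products of neighbouring columns, \<open>Y\<close>
    those within one column. Since \<open>P (Suc k) = P k * l k\<close>, the factor
    \<open>l k\<close> of the recurrence is absorbed into the weight, and the total
    \<open>X m n + Y m n + X n m\<close> is symmetric.\<close>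
  define X where "X m n = (\<Sum>k<N. stieltjes b l m k * stieltjes b l n (Suc k) * P (Suc k))" for m n
  define Y where "Y m n = (\<Sum>k\<le>N. b k * stieltjes b l m k * stieltjes b l n k * P k)" for m n
  have *: "(\<Sum>k\<le>N. stieltjes b l (Suc m) k * stieltjes b l n k * P k) = X m n + Y m n + X n m"
    if "m < N" for m n
  proof -
    have "(\<Sum>k\<le>N. stieltjes b l (Suc m) k * stieltjes b l n k * P k)
        = (\<Sum>k\<le>N. (if k = 0 then 0 else stieltjes b l m (k - 1)) * stieltjes b l n k * P k)
          + Y m n + (\<Sum>k\<le>N. stieltjes b l n k * stieltjes b l m (Suc k) * P (Suc k))"
      unfolding Y_def P_def sum.distrib[symmetric]
      by (intro sum.cong refl) (simp add: algebra_simps)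
    also have "(\<Sum>k\<le>N. (if k = 0 then 0 else stieltjes b l m (k - 1)) * stieltjes b l n k * P k)
        = X m n"
      unfolding X_def by (cases N) (simp_all add: sum.atMost_Suc_shift lessThan_Suc_atMost that del: sum.atMost_Suc)
    also have "(\<Sum>k\<le>N. stieltjes b l n k * stieltjes b l m (Suc k) * P (Suc k)) = X n m"
      unfolding X_def using that by (simp add: lessThan_Suc_atMost[symmetric] stieltjes_eq_0)
    finally show ?thesis .
  qed
  have "Y m n = Y n m" unfolding Y_def by (simp add: mult_ac)
  then show ?thesis
    using *[OF assms(1), of n] *[OF assms(2), of m]
    by (simp add: P_def mult.commute mult.left_commute add_ac)
qed

text \<open>The shift symmetry moves one unit at a time from the second index to the first; for
  \<open>m = 0\<close> only the summand \<open>k = 0\<close> survives. Keeping \<open>N\<close>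
  fixed lets all these sums share one range.\<close>

lemma stieltjes_add_bounded:
  assumes "m + n \<le> N"
  shows "stieltjes b l (m + n) 0 = (\<Sum>k\<le>N. stieltjes b l m k * stieltjes b l n k * (\<Prod>i<k. l i))"
  using assms
proof (induction m arbitrary: n)
  case 0
  have "(\<Sum>k\<le>N. stieltjes b l 0 k * stieltjes b l n k * (\<Prod>i<k. l i))
      = (\<Sum>k\<le>N. if k = 0 then stieltjes b l n 0 else 0)"
    by (intro sum.cong) auto
  then show ?case by simp
next
  case (Suc m)
  have "stieltjes b l (Suc m + n) 0 = stieltjes b l (m + Suc n) 0" by simp
  also have "\<dots> = (\<Sum>k\<le>N. stieltjes b l m k * stieltjes b l (Suc n) k * (\<Prod>i<k. l i))"
    using Suc by (intro Suc.IH) simp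
  also have "\<dots> = (\<Sum>k\<le>N. stieltjes b l (Suc m) k * stieltjes b l n k * (\<Prod>i<k. l i))"
  proof (cases "n < N")
    case True
    then show ?thesis using Suc.prems by (intro stieltjes_shift[symmetric]) auto
  next
    case False
    then show ?thesis using Suc.prems by auto
  qed
  finally show ?case .
qed

text \<open>Entries right of the diagonal vanish, so bounding \<open>n\<close> alone suffices to cut
  the sum. The freedom in \<open>m\<close> serves the shifted Hankel matrix, whose row index
  \<open>Suc i\<close> can reach its size.\<close>

lemma stieltjes_add:
  assumes "n < N"
  shows "stieltjes b l (m + n) 0 = (\<Sum>k<N. stieltjes b l m k * stieltjes b l n k * (\<Prod>i<k. l i))"
proof -
  have "stieltjes b l (m + n) 0
      = (\<Sum>k\<le>m + N. stieltjes b l m k * stieltjes b l n k * (\<Prod>i<k. l i))"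
    using assms by (intro stieltjes_add_bounded) simp
  also have "\<dots> = (\<Sum>k<N. stieltjes b l m k * stieltjes b l n k * (\<Prod>i<k. l i))"
    using assms by (intro sum.mono_neutral_right) (auto simp: stieltjes_eq_0)
  finally show ?thesis .
qed

section \<open>Jacobi matrices and Hankel determinants of first columns\<close>

definition jacobi_mat :: "(nat \<Rightarrow> 'a::comm_ring_1) \<Rightarrow> (nat \<Rightarrow> 'a) \<Rightarrow> nat \<Rightarrow> 'a mat" where
  "jacobi_mat b l n = mat n n (\<lambda>(i, k).
     if k = Suc i then 1 else if k = i then b k else if i = Suc k then l k else 0)"

lemma det_stieltjes_mat:
  "det (mat n n (\<lambda>(i, k). stieltjes b l i k)) = 1"
proof -
  have "det (mat n n (\<lambda>(i, k). stieltjes b l i k))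
      = prod_list (diag_mat (mat n n (\<lambda>(i, k). stieltjes b l i k)))"
    by (rule det_lower_triangular[where n = n]) (auto simp: stieltjes_eq_0)
  also have "\<dots> = 1"
    by (simp add: diag_mat_def stieltjes_diag prod.list_conv_set_nth)
  finally show ?thesis .
qed

text \<open>This is the factor \<open>D L^T\<close>, with the diagonal matrix already multiplied in;
  its diagonal is that of \<open>D\<close> because \<open>L\<close> is unitriangular.\<close>

lemma det_stieltjes_weighted:
  "det (mat n n (\<lambda>(k, j). stieltjes b l j k * (\<Prod>i<k. l i))) = (\<Prod>k<n. \<Prod>i<k. l i)"
proof -
  have "det (mat n n (\<lambda>(k, j). stieltjes b l j k * (\<Prod>i<k. l i)))
      = prod_list (diag_mat (mat n n (\<lambda>(k, j). stieltjes b l j k * (\<Prod>i<k. l i))))"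
    by (rule det_upper_triangular[where n = n]) (auto simp: stieltjes_eq_0)
  also have "\<dots> = (\<Prod>k<n. \<Prod>i<k. l i)"
    by (simp add: diag_mat_def stieltjes_diag prod.list_conv_set_nth atLeast0LessThan)
  finally show ?thesis .
qed

lemma det_hankel_stieltjes:
  "det (mat n n (\<lambda>(i, j). stieltjes b l (i + j) 0)) = (\<Prod>k<n. \<Prod>i<k. l i)"
proof -
  let ?L = "mat n n (\<lambda>(i, k). stieltjes b l i k)"
  let ?U = "mat n n (\<lambda>(k, j). stieltjes b l j k * (\<Prod>i<k. l i))"
  have "mat n n (\<lambda>(i, j). stieltjes b l (i + j) 0) = ?L * ?U"
    by (rule eq_matI)
       (simp_all add: scalar_prod_def stieltjes_add[where N = n] atLeast0LessThan mult.assoc)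
  then show ?thesis
    by (simp add: det_mult[where n = n] det_stieltjes_mat det_stieltjes_weighted)
qed

text \<open>Only the last column \<open>k = n - 1\<close> feels the truncation: its summand
  \<open>l k * stieltjes b l i n\<close> is cut off, and this is zero because
  \<open>i < n\<close>.\<close>

lemma stieltjes_mult_jacobi:
  assumes "i < n" "k < n"
  shows "(\<Sum>j<n. stieltjes b l i j * jacobi_mat b l n $$ (j, k)) = stieltjes b l (Suc i) k"
proof -
  have "(\<Sum>j<n. stieltjes b l i j * jacobi_mat b l n $$ (j, k))
      = (\<Sum>j<n. (if k \<noteq> 0 \<and> j = k - 1 then stieltjes b l i (k - 1) else 0)
           + (if j = k then b k * stieltjes b l i k else 0)
           + (if j = Suc k then l k * stieltjes b l i (Suc k) else 0))"
    using assms by (intro sum.cong refl) (auto simp: jacobi_mat_def mult.commute)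
  also have "\<dots> = stieltjes b l (Suc i) k"
    using assms by (cases k) (auto simp: sum.distrib stieltjes_eq_0)
  finally show ?thesis .
qed

lemma det_hankel_stieltjes_Suc:
  "det (mat n n (\<lambda>(i, j). stieltjes b l (Suc (i + j)) 0))
     = det (jacobi_mat b l n) * (\<Prod>k<n. \<Prod>i<k. l i)"
proof -
  let ?L = "mat n n (\<lambda>(i, k). stieltjes b l i k)"
  let ?U = "mat n n (\<lambda>(k, j). stieltjes b l j k * (\<Prod>i<k. l i))"
  let ?J = "jacobi_mat b l n"
  have J: "?J \<in> carrier_mat n n" by (simp add: jacobi_mat_def)
  have LJ: "?L * ?J = mat n n (\<lambda>(i, k). stieltjes b l (Suc i) k)"
    using J stieltjes_mult_jacobi[where b = b and l = l and n = n]
    by (intro eq_matI) (auto simp: scalar_prod_def atLeast0LessThan simp del: stieltjes.simps)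
  have "mat n n (\<lambda>(i, j). stieltjes b l (Suc (i + j)) 0) = (?L * ?J) * ?U"
  proof (rule eq_matI)
    fix i j assume "i < dim_row ((?L * ?J) * ?U)" "j < dim_col ((?L * ?J) * ?U)"
    then have "i < n" "j < n" by auto
    then show "mat n n (\<lambda>(i, j). stieltjes b l (Suc (i + j)) 0) $$ (i, j) = ((?L * ?J) * ?U) $$ (i, j)"
      using stieltjes_add[of j n b l "Suc i"] unfolding LJ
      by (simp add: scalar_prod_def atLeast0LessThan mult.assoc del: stieltjes.simps)
  qed auto
  then have "det (mat n n (\<lambda>(i, j). stieltjes b l (Suc (i + j)) 0)) = det (?L * ?J) * det ?U"
    using det_mult[OF mult_carrier_mat[OF mat_carrier J] mat_carrier] by simp
  then show ?thesis
    using J by (simp add: det_mult[where n = n] det_stieltjes_mat det_stieltjes_weighted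
        del: stieltjes.simps)
qed

text \<open>\<open>D\<close> stays abstract, so that a closed form can be inserted once its
  continuant recurrence is verified.\<close>

lemma det_jacobi_mat:
  assumes D0: "D 0 = 1" and D1: "D (Suc 0) = b 0"
    and rec: "\<And>n. D (Suc (Suc n)) = b (Suc n) * D (Suc n) - l n * D n"
  shows "det (jacobi_mat b l n) = D n"
proof (cases n)
  case 0
  then show ?thesis by (simp add: D0 jacobi_mat_def)
next
  case (Suc m)
  let ?J = "jacobi_mat b l n"
  \<comment> \<open>The vector \<open>(-1)^k D k\<close> is annihilated by all rows of the Jacobi matrix but the last,
    so putting it in the first column leaves a single cofactor to compute.\<close>
  define p where "p k = (-1) ^ k * D k" for k
  define M where "M = mat n n (\<lambda>(i, k). if k = 0 then p i else if i = k then 1 else 0)"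
  define Q where "Q = mat n n (\<lambda>(i, k). if k = 0 then (if i = m then (-1) ^ m * D n else 0)
    else ?J $$ (i, k))"
  have J: "?J \<in> carrier_mat n n" and M: "M \<in> carrier_mat n n" and Q: "Q \<in> carrier_mat n n"
    by (simp_all add: jacobi_mat_def M_def Q_def)
  have col0: "(\<Sum>k<n. ?J $$ (i, k) * p k) = (if i = m then (-1) ^ m * D n else 0)" if "i < n" for i
  proof -
    have "(\<Sum>k<n. ?J $$ (i, k) * p k)
        = (\<Sum>k<n. (if i \<noteq> 0 \<and> k = i - 1 then l (i - 1) * p (i - 1) else 0)
             + (if k = i then b i * p i else 0) + (if k = Suc i then p (Suc i) else 0))"
      using that by (intro sum.cong refl) (auto simp: jacobi_mat_def)
    also have "\<dots> = (if i \<noteq> 0 then l (i - 1) * p (i - 1) else 0) + b i * p i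
        + (if i = m then 0 else p (Suc i))"
      using that Suc by (auto simp: sum.distrib)
    also have "\<dots> = (if i = m then (-1) ^ m * D n else 0)"
      using Suc by (cases i) (auto simp: p_def D0 D1 rec algebra_simps)
    finally show ?thesis .
  qed
  have "?J * M = Q"
  proof (rule eq_matI)
    fix i k assume "i < dim_row Q" "k < dim_col Q"
    then have ik: "i < n" "k < n" by (auto simp: Q_def)
    have "(?J * M) $$ (i, k) = (\<Sum>j<n. ?J $$ (i, j) * M $$ (j, k))"
      using ik J M by (simp add: scalar_prod_def atLeast0LessThan)
    also have "\<dots> = Q $$ (i, k)"
    proof (cases "k = 0")
      case True
      then show ?thesis using ik col0[OF ik(1)] by (simp add: M_def Q_def)
    next
      case False
      have "(\<Sum>j<n. ?J $$ (i, j) * M $$ (j, k)) = (\<Sum>j<n. if j = k then ?J $$ (i, k) else 0)"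
        using ik False by (intro sum.cong refl) (auto simp: M_def)
      then show ?thesis using ik False by (simp add: Q_def)
    qed
    finally show "(?J * M) $$ (i, k) = Q $$ (i, k)" .
  qed (use J M Q in auto)
  moreover have "det M = 1"
  proof -
    have "det M = prod_list (diag_mat M)"
      by (rule det_lower_triangular[OF _ M]) (auto simp: M_def)
    also have "\<dots> = 1"
      by (auto simp: diag_mat_def M_def prod.list_conv_set_nth p_def D0 intro!: prod.neutral)
    finally show ?thesis .
  qed
  moreover have "det Q = D n"
  proof -
    have "det Q = (\<Sum>i<n. Q $$ (i, 0) * cofactor Q i 0)"
      using laplace_expansion_column[OF Q, of 0] Suc by simp
    also have "\<dots> = (\<Sum>i<n. if i = m then (-1) ^ m * D n * cofactor Q m 0 else 0)"
      using Suc by (intro sum.cong refl) (auto simp: Q_def)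
    also have "\<dots> = (-1) ^ m * D n * cofactor Q m 0"
      using Suc by simp
    \<comment> \<open>Deleting the last row and the first column moves the superdiagonal of ones
      onto the diagonal of a lower triangular matrix, so only the sign remains.\<close>
    also have "cofactor Q m 0 = (-1) ^ m"
    proof -
      let ?R = "mat_delete Q m 0"
      have R: "?R \<in> carrier_mat m m"
        using Q Suc by (auto simp: mat_delete_def)
      have ent: "?R $$ (i, k) = ?J $$ (i, Suc k)" if "i < m" "k < m" for i k
        using that Suc by (simp add: mat_delete_def Q_def)
      have "det ?R = prod_list (diag_mat ?R)"
        by (rule det_lower_triangular[OF _ R]) (use Suc in \<open>auto simp: ent jacobi_mat_def\<close>)
      also have "\<dots> = 1"
        using R Suc by (auto simp: diag_mat_def ent jacobi_mat_def prod.list_conv_set_nth intro!: prod.neutral)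
      finally show ?thesis by (simp add: cofactor_def)
    qed
    finally show ?thesis by (simp add: power_mult_distrib[symmetric] mult_ac)
  qed
  ultimately show ?thesis using det_mult[OF J M] by simp
qed

section \<open>The \<open>q\<close>-factorials and the recurrence coefficients belonging to
  \<open>phi\<close>\<close>

lemma qfact_Suc: "qfact q (Suc n) = qfact q n * qbracket q (1 + real n)"
  by (simp add: qfact_def)

lemma qbinom_eq_0: "n < k \<Longrightarrow> qbinom q n k = 0"
  by (simp add: qbinom_def)

lemma qStirling_eq_0: "n < k \<Longrightarrow> qStirling q r n k = 0"
  by (induction q r n k rule: qStirling.induct) auto

definition phi_jacobi_diag :: "real \<Rightarrow> real \<Rightarrow> nat \<Rightarrow> real poly" where
  "phi_jacobi_diag q r k = [:qbracket q (real k + r):] + monom (q ^ k) 1"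

definition phi_jacobi_sub :: "real \<Rightarrow> real \<Rightarrow> nat \<Rightarrow> real poly" where
  "phi_jacobi_sub q r k = monom (q ^ k * q powr r * qbracket q (1 + real k)) 1"

definition phi_continuant :: "real \<Rightarrow> real \<Rightarrow> nat \<Rightarrow> real poly" where
  "phi_continuant q r n = (\<Sum>k=0..n. monom (qbinom q n k * q ^ (k choose 2)
     * (\<Prod>j=0..<n - k. qbracket q (r + real j))) k)"

lemma coeff_phi_continuant:
  "coeff (phi_continuant q r n) k
     = qbinom q n k * q ^ (k choose 2) * (\<Prod>j=0..<n - k. qbracket q (r + real j))"
  by (simp add: phi_continuant_def coeff_sum qbinom_eq_0)

lemma prod_phi_jacobi_sub:
  "(\<Prod>i<k. phi_jacobi_sub q r i) = monom (q ^ (k choose 2) * (q powr r) ^ k * qfact q k) k"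
proof (induction k)
  case 0
  then show ?case by (simp add: qfact_def binomial_eq_0 one_pCons monom_0)
next
  case (Suc k)
  then show ?case
    by (simp add: phi_jacobi_sub_def mult_monom qfact_Suc numeral_2_eq_2 power_add mult_ac)
qed

text \<open>The exponents add up by the hockey-stick identity: summing \<open>k choose 2\<close>
  over \<open>k < n\<close> gives \<open>n choose 3\<close>, and summing \<open>k\<close> gives
  \<open>n choose 2\<close>.\<close>

lemma prod_prod_phi_jacobi_sub:
  "(\<Prod>k<n. \<Prod>i<k. phi_jacobi_sub q r i)
     = [:q ^ (n choose 3):] * monom (q powr r) 1 ^ (n choose 2) * [:\<Prod>k=0..<n. qfact q k:]"
proof (induction n)
  case 0
  then show ?case by (simp add: binomial_eq_0)
next
  case (Suc n)
  have choose3: "(n choose 2) + (n choose 3) = Suc n choose 3"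
    by (simp add: numeral_3_eq_3 numeral_2_eq_2)
  have choose2: "n + (n choose 2) = Suc n choose 2"
    by (simp add: numeral_2_eq_2)
  show ?case
    unfolding prod.lessThan_Suc Suc.IH
    by (simp add: prod_phi_jacobi_sub monom_power smult_monom mult_monom power_add
        add.commute mult_ac monom_0[symmetric] choose2[symmetric] choose3[symmetric]
        del: binomial_Suc_Suc)
qed

section \<open>Identities for \<open>q\<close>-brackets and \<open>q\<close>-binomials\<close>

context
  fixes q :: real
  assumes q_pos: "q > 0" and q_neq_1: "q \<noteq> 1"
begin

lemma qbracket_add: "qbracket q (s + t) = qbracket q s + q powr s * qbracket q t"
  using q_neq_1 by (simp add: qbracket_def powr_add field_simps)

lemma qbracket_add_nat: "qbracket q (real n + t) = qbracket q (real n) + q ^ n * qbracket q t"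
  using qbracket_add q_pos by (simp add: powr_realpow)

lemma qbracket_Suc_neq_0: "qbracket q (1 + real n) \<noteq> 0"
proof -
  have "q powr (1 + real n) \<noteq> 1"
    using q_pos q_neq_1 by (simp add: powr_eq_one_iff_gen)
  then show ?thesis using q_neq_1 by (simp add: qbracket_def)
qed

lemma qfact_neq_0: "qfact q n \<noteq> 0"
  by (induction n) (auto simp: qfact_Suc qbracket_Suc_neq_0, simp add: qfact_def)

lemma qbinom_0_right: "qbinom q n 0 = 1"
  using qfact_neq_0[of n] by (simp add: qbinom_def) (simp add: qfact_def)

lemma qbinom_self: "qbinom q n n = 1"
  using qfact_neq_0[of n] by (simp add: qbinom_def) (simp add: qfact_def)

text \<open>The difference is taken in the reals: at \<open>n = k\<close> the right side has the
  factor \<open>[0] = 0\<close>, and for \<open>n < k\<close> both binomials vanish.\<close>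

lemma qbinom_absorb:
  "qbracket q (1 + real k) * qbinom q n (Suc k) = qbracket q (real n - real k) * qbinom q n k"
proof -
  consider "n < k" | "n = k" | d where "n = Suc (k + d)"
    using less_imp_Suc_add by fastforce
  then show ?thesis
  proof cases
    case 2
    then show ?thesis using q_pos by (simp add: qbinom_eq_0 qbracket_def)
  next
    case 3
    have "n - k = Suc d" "n - Suc k = d" "real n - real k = 1 + real d" using 3 by auto
    then show ?thesis
      using 3 qfact_neq_0 qbracket_Suc_neq_0 by (simp add: qbinom_def qfact_Suc field_simps)
  qed (simp add: qbinom_eq_0)
qed

lemma qbinom_Suc_Suc_absorb:
  "qbracket q (1 + real k) * qbinom q (Suc n) (Suc k) = qbracket q (1 + real n) * qbinom q n k"
  using qfact_neq_0 qbracket_Suc_neq_0 by (simp add: qbinom_def qfact_Suc field_simps)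

text \<open>After multiplication by the nonzero \<open>[k+1]\<close>, this is the splitting
  \<open>[n+1] = [k+1] + q^(k+1) [n-k]\<close> combined with the two absorption rules.\<close>

lemma qbinom_pascal:
  "qbinom q (Suc n) (Suc k) = qbinom q n k + q ^ Suc k * qbinom q n (Suc k)"
proof -
  have eq: "qbracket q (1 + real n) = qbracket q (1 + real k) + q ^ Suc k * qbracket q (real n - real k)"
    using qbracket_add_nat[of "Suc k" "real n - real k"] by simp
  have "qbracket q (1 + real k) * qbinom q (Suc n) (Suc k)
      = qbracket q (1 + real k) * qbinom q n k
        + q ^ Suc k * (qbracket q (real n - real k) * qbinom q n k)"
    unfolding qbinom_Suc_Suc_absorb eq by (simp add: algebra_simps)
  also have "\<dots> = qbracket q (1 + real k) * (qbinom q n k + q ^ Suc k * qbinom q n (Suc k))"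
    using qbinom_absorb[of k n] by (simp add: algebra_simps)
  finally show ?thesis using qbracket_Suc_neq_0 by simp
qed

text \<open>Same argument with the opposite splitting
  \<open>[n+1] = [n-k] + q^(n-k) [k+1]\<close>.\<close>

lemma qbinom_pascal':
  assumes "k \<le> n"
  shows "qbinom q (Suc n) (Suc k) = qbinom q n (Suc k) + q ^ (n - k) * qbinom q n k"
proof -
  have eq: "qbracket q (1 + real n) = qbracket q (real n - real k) + q ^ (n - k) * qbracket q (1 + real k)"
    using qbracket_add_nat[of "n - k" "1 + real k"] assms by (simp add: of_nat_diff add.commute)
  have "qbracket q (1 + real k) * qbinom q (Suc n) (Suc k)
      = qbracket q (real n - real k) * qbinom q n k
        + qbracket q (1 + real k) * (q ^ (n - k) * qbinom q n k)"
    unfolding qbinom_Suc_Suc_absorb eq by (simp add: algebra_simps)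
  also have "\<dots> = qbracket q (1 + real k) * (qbinom q n (Suc k) + q ^ (n - k) * qbinom q n k)"
    using qbinom_absorb[of k n] by (simp add: algebra_simps)
  finally show ?thesis using qbracket_Suc_neq_0 by simp
qed

section \<open>\<open>phi\<close> as a first column, and the continuant of its Jacobi matrix\<close>

lemma monom_qbinom_step:
  "monom (qbinom q (Suc j) k) (Suc j - k) + smult (qbracket q (real j + r)) (monom (qbinom q j k) (j - k))
   = (if k = 0 then 0 else monom (qbinom q j (k - 1)) (j - (k - 1)))
     + phi_jacobi_diag q r k * monom (qbinom q j k) (j - k)
     + phi_jacobi_sub q r k * monom (qbinom q j (Suc k)) (j - Suc k)"
proof (cases "k \<le> j")
  case True
  \<comment> \<open>The splitting \<open>[j+r] = [k+r] + q^(k+r) [j-k]\<close> separates the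
    constant part of the diagonal coefficient from a rest that absorption turns into the
    \<open>phi_jacobi_sub\<close> term. Pascal's rule supplies the remaining two terms.\<close>
  have "qbracket q (real j + r) = qbracket q (real k + r) + q ^ k * q powr r * qbracket q (real j - real k)"
    using qbracket_add[of "real k + r" "real j - real k"] q_pos
    by (simp add: powr_add powr_realpow add_ac)
  then have "qbracket q (real j + r) * qbinom q j k
      = qbracket q (real k + r) * qbinom q j k
        + q ^ k * q powr r * (qbracket q (1 + real k) * qbinom q j (Suc k))"
    using qbinom_absorb[of k j] by (simp add: algebra_simps)
  moreover have "monom (qbinom q (Suc j) k) (Suc j - k)
      = (if k = 0 then 0 else monom (qbinom q j (k - 1)) (j - (k - 1)))
        + monom (q ^ k) 1 * monom (qbinom q j k) (j - k)"
    using True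
    by (cases k) (simp_all add: mult_monom qbinom_0_right qbinom_pascal Suc_diff_le Suc_diff_Suc add_monom)
  moreover have "phi_jacobi_sub q r k * monom (qbinom q j (Suc k)) (j - Suc k)
      = monom (q ^ k * q powr r * (qbracket q (1 + real k) * qbinom q j (Suc k))) (j - k)"
    \<comment> \<open>For \<open>k = j\<close> the exponent \<open>j - Suc k\<close> is truncated to
      0, but then both sides carry the coefficient \<open>qbinom q j (Suc j) = 0\<close>.\<close>
    using True
    by (cases "k = j") (simp_all add: phi_jacobi_sub_def mult_monom qbinom_eq_0 Suc_diff_Suc mult_ac)
  ultimately show ?thesis
    by (simp add: phi_jacobi_diag_def smult_monom distrib_left add_monom[symmetric] mult_ac)
next
  case False
  then consider "k = Suc j" | "k > Suc j" by linarith
  then show ?thesis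
    by cases (simp_all add: qbinom_eq_0 qbinom_self)
qed

text \<open>Expanding \<open>S(n+1,j)\<close> and regrouping by \<open>S(n,j)\<close> leaves, for
  each \<open>j\<close>, exactly the left side of \<open>monom_qbinom_step\<close>.\<close>

lemma stieltjes_phi:
  "stieltjes (phi_jacobi_diag q r) (phi_jacobi_sub q r) n k
     = (\<Sum>j\<le>n. smult (qStirling q r n j) (monom (qbinom q j k) (j - k)))"
proof (induction n arbitrary: k)
  case 0
  show ?case by (auto simp: qbinom_0_right qbinom_eq_0 monom_0 one_pCons)
next
  case (Suc n)
  define c where "c j k = monom (qbinom q j k) (j - k)" for j k
  let ?S = "qStirling q r"
  have IH: "stieltjes (phi_jacobi_diag q r) (phi_jacobi_sub q r) n k
      = (\<Sum>j\<le>n. smult (?S n j) (c j k))" for k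
    unfolding c_def by (rule Suc.IH)
  have "(\<Sum>j\<le>Suc n. smult (?S (Suc n) j) (c j k))
      = (\<Sum>j\<le>Suc n. smult (if j = 0 then 0 else ?S n (j - 1)) (c j k)
          + smult (qbracket q (real j + r) * ?S n j) (c j k))"
  proof (intro sum.cong refl)
    fix j
    have "?S (Suc n) j = (if j = 0 then 0 else ?S n (j - 1)) + qbracket q (real j + r) * ?S n j"
      by (cases j; cases n) auto
    then show "smult (?S (Suc n) j) (c j k) = smult (if j = 0 then 0 else ?S n (j - 1)) (c j k)
        + smult (qbracket q (real j + r) * ?S n j) (c j k)"
      by (simp add: smult_add_left)
  qed
  \<comment> \<open>The first sum is shifted by one; the second loses its top term because
    \<open>S(n,n+1) = 0\<close>.\<close>
  also have "\<dots> = (\<Sum>j\<le>n. smult (?S n j) (c (Suc j) k))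
      + (\<Sum>j\<le>n. smult (?S n j) (smult (qbracket q (real j + r)) (c j k)))"
    unfolding sum.distrib
    by (subst sum.atMost_Suc_shift) (simp add: qStirling_eq_0 mult.commute)
  also have "\<dots> = (\<Sum>j\<le>n. smult (?S n j) (c (Suc j) k + smult (qbracket q (real j + r)) (c j k)))"
    by (simp add: sum.distrib smult_add_right)
  also have "\<dots> = (\<Sum>j\<le>n. smult (?S n j) ((if k = 0 then 0 else c j (k - 1))
        + phi_jacobi_diag q r k * c j k + phi_jacobi_sub q r k * c j (Suc k)))"
    unfolding c_def monom_qbinom_step ..
  also have "\<dots> = stieltjes (phi_jacobi_diag q r) (phi_jacobi_sub q r) (Suc n) k"
    by (simp add: IH smult_add_right sum.distrib sum_distrib_left)
  finally show ?case by (simp only: c_def)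
qed

lemma phi_eq_stieltjes:
  "phi q r n = stieltjes (phi_jacobi_diag q r) (phi_jacobi_sub q r) n 0"
  by (simp add: stieltjes_phi phi_def qbinom_0_right smult_monom atLeast0AtMost)

text \<open>Coefficients are compared. At \<open>x^(i+1)\<close> with \<open>i <= n\<close>,
  splitting \<open>[n+1+r] = [r+n-i] + q^(n-i+r) [i+1]\<close> produces a term with
  \<open>q^r\<close> that cancels the subtracted one by absorption; what is left is
  \<open>qbinom_pascal'\<close> for \<open>n + 2\<close>.\<close>

lemma phi_continuant_rec:
  "phi_continuant q r (Suc (Suc n))
     = phi_jacobi_diag q r (Suc n) * phi_continuant q r (Suc n)
       - phi_jacobi_sub q r n * phi_continuant q r n"
proof (rule poly_eqI)
  fix k
  define A where "A n = (\<Prod>j=0..<n. qbracket q (r + real j))" for n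
  show "coeff (phi_continuant q r (Suc (Suc n))) k
     = coeff (phi_jacobi_diag q r (Suc n) * phi_continuant q r (Suc n)
       - phi_jacobi_sub q r n * phi_continuant q r n) k"
  proof (cases k)
    case 0
    then show ?thesis
      by (simp add: phi_jacobi_diag_def phi_jacobi_sub_def distrib_right coeff_monom_mult
          coeff_phi_continuant qbinom_0_right binomial_eq_0)
        (simp add: algebra_simps)
  next
    case (Suc i)
    let ?N = "Suc n"
    have lhs: "coeff (phi_continuant q r (Suc ?N)) k
        = qbinom q (Suc ?N) (Suc i) * (q ^ i * q ^ (i choose 2)) * A (?N - i)"
      by (simp add: coeff_phi_continuant Suc A_def numeral_2_eq_2 power_add)
    have rhs: "coeff (phi_jacobi_diag q r ?N * phi_continuant q r ?N
          - phi_jacobi_sub q r n * phi_continuant q r n) k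
        = qbracket q (real ?N + r) * (qbinom q ?N (Suc i) * (q ^ i * q ^ (i choose 2)) * A (n - i))
          + q ^ ?N * (qbinom q ?N i * q ^ (i choose 2) * A (?N - i))
          - q ^ n * q powr r * (qbracket q (1 + real n) * qbinom q n i) * q ^ (i choose 2) * A (n - i)"
      by (simp add: phi_jacobi_diag_def phi_jacobi_sub_def distrib_right coeff_monom_mult
          coeff_phi_continuant Suc A_def numeral_2_eq_2 power_add)
    consider "i \<le> n" | "i = ?N" | "i > ?N" by linarith
    then show ?thesis
    proof cases
      case 1
      have A: "A (?N - i) = A (n - i) * qbracket q (r + real (n - i))"
        using 1 by (simp add: A_def Suc_diff_le)
      have qn: "q ^ n = q ^ (n - i) * q ^ i" "q ^ ?N = q ^ (?N - i) * q ^ i"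
        using 1 by (simp_all flip: power_add)
      have br: "qbracket q (real ?N + r)
          = qbracket q (r + real (n - i)) + q ^ (n - i) * q powr r * qbracket q (1 + real i)"
      proof -
        have "q powr (r + real (n - i)) = q ^ (n - i) * q powr r"
          using q_pos by (simp only: powr_add powr_realpow mult.commute)
        moreover have "real ?N + r = (r + real (n - i)) + (1 + real i)"
          using 1 by simp
        ultimately show ?thesis by (simp only: qbracket_add)
      qed
      have "qbracket q (1 + real n) * qbinom q n i = qbracket q (1 + real i) * qbinom q ?N (Suc i)"
        by (simp add: qbinom_Suc_Suc_absorb)
      then show ?thesis
        unfolding lhs rhs A br using 1
        by (simp only: qn qbinom_pascal') (simp add: qbinom_pascal' algebra_simps)
    next
      case 2
      \<comment> \<open>In the top degree \<open>n + 2\<close> only the \<open>q^(n+1) x\<close>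
        part of the diagonal coefficient contributes.\<close>
      then show ?thesis
        unfolding lhs rhs by (simp add: qbinom_self qbinom_eq_0)
    next
      case 3
      then show ?thesis
        unfolding lhs rhs by (simp add: qbinom_eq_0)
    qed
  qed
qed

lemma det_jacobi_phi:
  "det (jacobi_mat (phi_jacobi_diag q r) (phi_jacobi_sub q r) n) = phi_continuant q r n"
proof (rule det_jacobi_mat)
  show "phi_continuant q r 0 = 1"
    by (simp add: phi_continuant_def qbinom_self binomial_eq_0 monom_0 one_pCons)
  show "phi_continuant q r (Suc 0) = phi_jacobi_diag q r 0"
    by (simp add: phi_continuant_def phi_jacobi_diag_def qbinom_self qbinom_0_right
        binomial_eq_0 monom_0 add.commute)
qed (rule phi_continuant_rec)

end

theorem theorem2p1:
  fixes q r :: real and n :: nat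
  assumes "q > 0" and "q \<noteq> 1" and "n \<ge> 1"
  shows "hankel_det q r n 0 =
           [:q ^ (n choose 3):] * monom (q powr r) 1 ^ (n choose 2)
             * [:\<Prod>k=0..<n. qfact q k:]
         \<and>
         hankel_det q r n 1 =
           [:q ^ (n choose 3):] * monom (q powr r) 1 ^ (n choose 2)
             * [:\<Prod>k=0..<n. qfact q k:]
             * (\<Sum>k=0..n. monom (qbinom q n k * q ^ (k choose 2)
                  * (\<Prod>j=0..<n - k. qbracket q (r + real j))) k)"
proof
  note phi = phi_eq_stieltjes[OF assms(1,2)]
  show "hankel_det q r n 0 =
           [:q ^ (n choose 3):] * monom (q powr r) 1 ^ (n choose 2)
             * [:\<Prod>k=0..<n. qfact q k:]"
    unfolding hankel_det_def phi add_0_right det_hankel_stieltjes prod_prod_phi_jacobi_sub ..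
  show "hankel_det q r n 1 =
           [:q ^ (n choose 3):] * monom (q powr r) 1 ^ (n choose 2)
             * [:\<Prod>k=0..<n. qfact q k:]
             * (\<Sum>k=0..n. monom (qbinom q n k * q ^ (k choose 2)
                  * (\<Prod>j=0..<n - k. qbracket q (r + real j))) k)"
    unfolding hankel_det_def phi Suc_eq_plus1[symmetric] det_hankel_stieltjes_Suc
      prod_prod_phi_jacobi_sub det_jacobi_phi[OF assms(1,2)] phi_continuant_def
    by (rule mult.commute)
qed

end
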